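(* For every integer $t\geq 1$, $$\sum_{(k_1,\dots,k_t)\in\mathcal{A}_t}\frac{q^{k_1+k_2+\cdots+k_t}}{\prod_{j=1}^t(1-q^{k_j})^2} =\sum_{k=1}^{\infty}\frac{(-1)^{k-1}(1+q^k)\,q^{\binom{k}{2}+tk}}{(1-q^k)^{2t}} =\sum_{(k_1,\dots,k_{2t-1})\in\mathcal{A}_{2t-1}}\frac{k_1\, q^{k_1+k_3+\cdots+k_{2t-1}}}{\prod_{j=1}^{2t-1}(1-q^{k_j})}.$$
   Context: For a positive integer $s$, $\mathcal{A}_s=\{(k_1,\dots,k_s)\in\mathbb{N}^s: k_1\leq k_2\leq\cdots\leq k_s\}$, where $\mathbb{N}=\{1,2,3,\dots\}$. The identities are between formal power series in $q$ (equivalently, for complex $|q|<1$). In the last sum the exponent of $q$ is the sum of all odd-indexed $k_i$, $i=1,3,\dots,2t-1$. *)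

theory Defs
  imports
    "HOL-Analysis.Infinite_Sum"
    "HOL-Computational_Algebra.Formal_Power_Series"
begin

text \<open>The tuple \<open>(k\<^sub>1, \<dots>, k\<^sub>s)\<close> is the list \<open>ks\<close> with \<open>k\<^sub>j = ks ! (j - 1)\<close>.
  Infinite sums of formal power series are taken in the library topology on
  \<open>'a fps\<close>, i.e. the \<open>q\<close>-adic one.\<close>

definition nondec_tuples :: "nat \<Rightarrow> nat list set" where
  "nondec_tuples s = {ks. length ks = s \<and> sorted ks \<and> (\<forall>k\<in>set ks. 1 \<le> k)}"

end

theory Submission imports Defs begin

text \<open>
  Write \<open>u\<^sub>k = 1 / (1 - q\<^sup>k)\<close> and \<open>a\<^sub>k = q\<^sup>k u\<^sub>k\<^sup>2\<close>, and let \<open>h\<^sub>t(N)\<close> be the part of the first sum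
  in which all entries are at most \<open>N\<close>: the complete homogeneous symmetric polynomial of degree
  \<open>t\<close> in \<open>a\<^sub>1, \<dots>, a\<^sub>N\<close>. The other two sums are compared with \<open>h\<^sub>t(N)\<close> through exact finite
  identities, in which each term of the limit acquires a factor that tends to 1.

  \<^item> Partial fractions in the distinct quantities \<open>a\<^sub>k\<close> express \<open>h\<^sub>t(N)\<close> as
    \<open>\<Sum>\<^sub>k c\<^sub>k a\<^sub>k\<^sup>t R(N,k)\<close> over \<open>1 \<le> k \<le> N\<close>, where \<open>c\<^sub>k\<close> is the alternating coefficient of the
    middle sum and \<open>R(N,k) = (q)\<^sub>N\<^sup>2 / ((q)\<^bsub>N-k\<^esub> (q)\<^bsub>N+k\<^esub>)\<close>. Once this formula is known, it is
    checked by showing that both sides obey \<open>h\<^sub>t(N+1) - h\<^sub>t(N) = a\<^bsub>N+1\<^esub> h\<^bsub>t-1\<^esub>(N+1)\<close>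
    (\<open>nested_sum_qweight\<close>); the starting value at \<open>t = 0\<close> is a telescoping sum.

  \<^item> In the third sum, the summation over each \<open>k\<^sub>i\<close> is an operator, \<open>A\<close> with weight \<open>q\<^sup>k u\<^sub>k\<close> for
    odd \<open>i\<close> and \<open>B\<close> with weight \<open>u\<^sub>k\<close> for even \<open>i\<close>, acting on functions of the upper bound \<open>N\<close>.
    Both are simple on the falling products
    \<open>r\<^sub>j(N) = (1 - q\<^sup>N)(1 - q\<^bsup>N-1\<^esup>) \<dots> (1 - q\<^bsup>N-j+1\<^esup>)\<close>: the \<open>r\<^sub>j\<close> are eigenfunctions of \<open>A\<close> with
    eigenvalue \<open>q\<^sup>j u\<^sub>j\<close>, and \<open>B r\<^sub>j = \<Sum>\<^bsub>i\<ge>j\<^esub> u\<^sub>i r\<^sub>i\<close>. Thus two consecutive summations,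
    \<open>B\<close> and then \<open>A\<close>, send \<open>r\<^sub>j\<close> to \<open>\<Sum>\<^bsub>i\<ge>j\<^esub> a\<^sub>i r\<^sub>i\<close>, which adds one further index \<open>i \<ge> j\<close>
    with weight \<open>a\<^sub>i\<close> to a chain as in the first sum. The factor \<open>k\<^sub>1\<close> is the right initial
    function because \<open>N = (B r\<^sub>1)(N) = \<Sum>\<^bsub>i\<ge>1\<^esub> u\<^sub>i r\<^sub>i(N)\<close>. Altogether the third sum, cut off at
    \<open>N\<close>, equals \<open>\<Sum>\<^sub>j a\<^sub>j r\<^sub>j(N) h\<^bsub>t-1\<^esub>(j)\<close> (\<open>nested_sum_parity\<close>), whereas
    \<open>h\<^sub>t(N) = \<Sum>\<^sub>j a\<^sub>j h\<^bsub>t-1\<^esub>(j)\<close>.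

  Since \<open>r\<^sub>j(N)\<close> and \<open>R(N,j)\<close> are 1 modulo \<open>q\<^bsup>N-j+1\<^esup>\<close> and \<open>a\<^sub>j\<close> is divisible by \<open>q\<^sup>j\<close>, replacing
  these factors by 1 changes nothing modulo \<open>q\<^bsup>N+1\<^esup>\<close>. Hence the three truncations have the same
  coefficient of \<open>q\<^sup>N\<close>. The terms cut off do not reach that coefficient, so it is also the
  coefficient of the full sums.
\<close>

unbundle fps_syntax

section \<open>Sums over nondecreasing tuples\<close>

definition bounded_tuples :: "nat \<Rightarrow> nat \<Rightarrow> nat list set" where
  "bounded_tuples s N = {ks \<in> nondec_tuples s. \<forall>k\<in>set ks. k \<le> N}"

fun nested_sum :: "(nat \<Rightarrow> nat \<Rightarrow> 'b::comm_semiring_1) \<Rightarrow> nat \<Rightarrow> nat \<Rightarrow> 'b" where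
  "nested_sum f 0 N = 1"
| "nested_sum f (Suc s) N = (\<Sum>k=1..N. f s k * nested_sum f s k)"

lemma bounded_tuples_0: "bounded_tuples 0 N = {[]}"
  by (auto simp: bounded_tuples_def nondec_tuples_def)

text \<open>Splitting off the last, hence largest, entry turns it into the bound for the others; this
  is the recursion of \<^const>\<open>nested_sum\<close>.\<close>
lemma bounded_tuples_Suc:
  "bounded_tuples (Suc s) N = (\<Union>k\<in>{1..N}. (\<lambda>ks. ks @ [k]) ` bounded_tuples s k)"
proof (intro set_eqI iffI)
  fix ks assume ks: "ks \<in> bounded_tuples (Suc s) N"
  then obtain js k where "ks = js @ [k]"
    by (cases ks rule: rev_cases) (auto simp: bounded_tuples_def nondec_tuples_def)
  with ks show "ks \<in> (\<Union>k\<in>{1..N}. (\<lambda>ks. ks @ [k]) ` bounded_tuples s k)"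
    by (auto simp: bounded_tuples_def nondec_tuples_def sorted_append)
qed (force simp: bounded_tuples_def nondec_tuples_def sorted_append)

lemma finite_bounded_tuples: "finite (bounded_tuples s N)"
  by (induction s arbitrary: N) (simp_all add: bounded_tuples_0 bounded_tuples_Suc)

lemma sum_bounded_tuples:
  "(\<Sum>ks\<in>bounded_tuples s N. \<Prod>j<s. f j (ks ! j)) = nested_sum f s N"
proof (induction s arbitrary: N)
  case 0
  then show ?case by (simp add: bounded_tuples_0)
next
  case (Suc s)
  have prod_append: "(\<Prod>j<Suc s. f j ((ks @ [k]) ! j)) = f s k * (\<Prod>j<s. f j (ks ! j))"
    if "ks \<in> bounded_tuples s k" for ks k
    using that by (simp add: bounded_tuples_def nondec_tuples_def nth_append mult.commute)
  have "(\<Sum>ks\<in>bounded_tuples (Suc s) N. \<Prod>j<Suc s. f j (ks ! j)) =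
        (\<Sum>k=1..N. \<Sum>ks\<in>(\<lambda>ks. ks @ [k]) ` bounded_tuples s k. \<Prod>j<Suc s. f j (ks ! j))"
    unfolding bounded_tuples_Suc by (subst sum.UNION_disjoint) (auto simp: finite_bounded_tuples)
  also have "\<dots> = (\<Sum>k=1..N. \<Sum>ks\<in>bounded_tuples s k. f s k * (\<Prod>j<s. f j (ks ! j)))"
    by (subst sum.reindex) (auto simp: inj_on_def prod_append simp del: prod.lessThan_Suc intro!: sum.cong)
  also have "\<dots> = nested_sum f (Suc s) N"
    by (simp add: sum_distrib_left [symmetric] Suc.IH)
  finally show ?case .
qed

section \<open>Summation of formal power series by truncation\<close>

text \<open>In the \<open>q\<close>-adic topology a sum converges as soon as every single coefficient is eventually
  constant. Summation over any finite set that includes \<open>A N\<close> gives the right coefficient of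
  \<open>q\<^sup>N\<close>, so one truncation per coefficient suffices.\<close>
lemma has_sum_fps_truncation:
  fixes f :: "'b \<Rightarrow> 'a::comm_ring_1 fps"
  assumes fin: "\<And>N. finite (A N)" and sub: "\<And>N. A N \<subseteq> B"
    and vanish: "\<And>N x. x \<in> B - A N \<Longrightarrow> f x $ N = 0"
    and coeff: "\<And>N. sum f (A N) $ N = S $ N"
  shows "(f has_sum S) B"
  unfolding has_sum_def
proof (rule tendsto_fpsI)
  fix N
  have "sum f Y $ N = S $ N" if "finite Y" "A N \<subseteq> Y" "Y \<subseteq> B" for Y
  proof -
    have "(\<Sum>x\<in>Y. f x $ N) = (\<Sum>x\<in>A N. f x $ N)"
      using that vanish by (intro sum.mono_neutral_right) auto
    then show ?thesis using coeff[of N] by (simp add: fps_sum_nth)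
  qed
  then show "eventually (\<lambda>Y. sum f Y $ N = S $ N) (finite_subsets_at_top B)"
    unfolding eventually_finite_subsets_at_top
    using fin[of N] sub[of N] by (intro exI[of _ "A N"]) simp
qed

lemma fps_nth_eq_0_of_X_power_dvd:
  fixes f :: "'a::comm_ring_1 fps"
  assumes "fps_X ^ m dvd f" "n < m"
  shows "f $ n = 0"
  using assms by (auto simp: dvd_def fps_X_power_mult_nth)

lemma fps_divide_eq_mult:
  fixes a d e :: "'a::field fps"
  assumes "d * e = 1"
  shows "a / d = a * e"
proof -
  have "d \<noteq> 0" using assms by auto
  have "a = (a * e) * d" using assms by (simp add: mult.assoc mult.commute[of e])
  then show ?thesis using \<open>d \<noteq> 0\<close> by (metis nonzero_mult_div_cancel_right)
qed

lemma dvd_prod_minus_1: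
  fixes f :: "'b \<Rightarrow> 'a::comm_ring_1"
  assumes "\<And>i. i \<in> I \<Longrightarrow> d dvd f i - 1"
  shows "d dvd prod f I - 1"
  using assms
proof (induction I rule: infinite_finite_induct)
  case (insert i I)
  have "prod f (insert i I) - 1 = (f i - 1) * prod f I + (prod f I - 1)"
    using insert by (simp add: algebra_simps)
  moreover have "d dvd (f i - 1) * prod f I" "d dvd prod f I - 1"
    using insert by auto
  ultimately show ?case by (simp only: dvd_add)
qed auto

section \<open>The factors of the summands\<close>

definition qinv :: "nat \<Rightarrow> 'a::field fps" where
  "qinv k = inverse (1 - fps_X ^ k)"

definition qweight :: "nat \<Rightarrow> 'a::field fps" where
  "qweight k = fps_X ^ k * (qinv k)\<^sup>2"

text \<open>This is \<open>(q)\<^sub>N / (q)\<^bsub>N-j\<^esub>\<close> for \<open>j \<le> N\<close>. For \<open>j > N\<close> the factor with \<open>i = N\<close> makes it vanish,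
  so that sums over \<open>j\<close> may be extended beyond \<open>N\<close> freely.\<close>
definition qfall :: "nat \<Rightarrow> nat \<Rightarrow> 'a::field fps" where
  "qfall N j = (\<Prod>i<j. 1 - fps_X ^ (N - i))"

text \<open>This is \<open>(q)\<^sub>N\<^sup>2 / ((q)\<^bsub>N-k\<^esub> (q)\<^bsub>N+k\<^esub>)\<close> for \<open>k \<le> N\<close>, and 0 for \<open>k > N\<close>.\<close>
definition qratio :: "nat \<Rightarrow> nat \<Rightarrow> 'a::field fps" where
  "qratio N k = (\<Prod>i<k. (1 - fps_X ^ (N - i)) * qinv (N + Suc i))"

lemma qinv: "k > 0 \<Longrightarrow> (1 - fps_X ^ k) * qinv k = 1"
  unfolding qinv_def by (rule inverse_mult_eq_1') simp

lemma qinv_mult: "k > 0 \<Longrightarrow> qinv k * (1 - fps_X ^ k) = 1"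
  by (subst mult.commute) (rule qinv)

lemma X_power_dvd_qinv:
  assumes "m \<le> k" "k > 0"
  shows "fps_X ^ m dvd (qinv k - 1 :: 'a::field fps)"
proof -
  have "qinv k - 1 = fps_X ^ k * (qinv k :: 'a fps)"
    using qinv[OF assms(2)] by (simp add: algebra_simps)
  then show ?thesis using assms by (simp add: le_imp_power_dvd)
qed

lemma qfall_0: "qfall N 0 = 1" by (simp add: qfall_def)
lemma qfall_Suc: "qfall N (Suc j) = qfall N j * (1 - fps_X ^ (N - j))" by (simp add: qfall_def)

lemma qfall_eq_0: "N < j \<Longrightarrow> qfall N j = 0"
  unfolding qfall_def by (rule prod_zero) (auto intro!: bexI[of _ N])

lemma qratio_eq_0: "N < j \<Longrightarrow> qratio N j = 0"
  unfolding qratio_def by (rule prod_zero) (auto intro!: bexI[of _ N])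

lemma qfall_shift:
  "j \<le> N \<Longrightarrow> (1 - fps_X ^ (Suc N - j)) * qfall (Suc N) j = (1 - fps_X ^ Suc N) * (qfall N j :: 'a::field fps)"
proof (induction j)
  case (Suc j)
  note IH = Suc.IH[OF Suc_leD[OF Suc.prems]]
  have "(1 - fps_X ^ (Suc N - Suc j)) * qfall (Suc N) (Suc j)
      = (1 - fps_X ^ (N - j)) * ((1 - fps_X ^ (Suc N - j)) * (qfall (Suc N) j :: 'a fps))"
    unfolding qfall_Suc diff_Suc_Suc by (simp only: mult_ac)
  also note IH
  finally have "(1 - fps_X ^ (Suc N - Suc j)) * qfall (Suc N) (Suc j)
      = (1 - fps_X ^ (N - j)) * ((1 - fps_X ^ Suc N) * (qfall N j :: 'a fps))" .
  then show ?case by (simp only: qfall_Suc mult_ac)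
qed (simp add: qfall_0)

lemma qfall_prev:
  assumes "j \<le> Suc N"
  shows "qfall N j = qinv (Suc N) * (1 - fps_X ^ (Suc N - j)) * (qfall (Suc N) j :: 'a::field fps)"
proof (cases "j \<le> N")
  case True
  have "qinv (Suc N) * ((1 - fps_X ^ (Suc N - j)) * qfall (Suc N) j)
      = ((1 - fps_X ^ Suc N) * qinv (Suc N)) * (qfall N j :: 'a fps)"
    unfolding qfall_shift[OF True] by (simp only: mult_ac)
  then show ?thesis unfolding qinv[OF zero_less_Suc] by (simp only: mult.assoc mult_1)
next
  case False
  then have "j = Suc N" using assms by simp
  then show ?thesis by (simp add: qfall_eq_0)
qed

lemma X_power_dvd_qfall: "fps_X ^ (Suc N - j) dvd (qfall N j - 1 :: 'a::field fps)"
  unfolding qfall_def by (rule dvd_prod_minus_1) (auto intro!: le_imp_power_dvd)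

lemma X_power_dvd_qratio: "fps_X ^ (Suc N - k) dvd (qratio N k - 1 :: 'a::field fps)"
proof -
  have "fps_X ^ (Suc N - k) dvd (\<Prod>i<k. 1 - fps_X ^ (N - i) :: 'a fps) - 1"
    by (rule dvd_prod_minus_1) (auto intro!: le_imp_power_dvd)
  moreover have "fps_X ^ (Suc N - k) dvd (\<Prod>i<k. qinv (N + Suc i) :: 'a fps) - 1"
    by (rule dvd_prod_minus_1) (auto intro!: X_power_dvd_qinv)
  moreover have "qratio N k - 1 = ((\<Prod>i<k. 1 - fps_X ^ (N - i)) - 1) * (\<Prod>i<k. qinv (N + Suc i))
       + ((\<Prod>i<k. qinv (N + Suc i)) - 1 :: 'a fps)"
    unfolding qratio_def prod.distrib by (simp only: left_diff_distrib) simp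
  ultimately show ?thesis by (simp only: dvd_add dvd_mult2)
qed

section \<open>Chains with weights alternating by parity\<close>

text \<open>The falling products are eigenfunctions of summation with weight \<open>q\<^sup>k / (1 - q\<^sup>k)\<close>. In the
  induction step, \<open>qfall N j\<close> is a multiple of \<open>qfall (Suc N) j\<close>, and the remaining identity
  between the factors is \<open>(1 - q\<^bsup>d+j\<^esup>) - (1 - q\<^sup>d) = q\<^sup>d (1 - q\<^sup>j)\<close>.\<close>
lemma sum_X_power_qinv_qfall:
  assumes "j > 0"
  shows "(\<Sum>k=1..N. fps_X ^ k * qinv k * qfall k j) = fps_X ^ j * qinv j * (qfall N j :: 'a::field fps)"
proof (induction N)
  case 0
  then show ?case using assms by (simp add: qfall_eq_0)
next
  case (Suc N)
  show ?case
  proof (cases "j \<le> Suc N")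
    case True
    define d where "d = Suc N - j"
    have N: "Suc N = d + j" using True by (simp add: d_def)
    have *: "qinv (Suc N) * (1 - fps_X ^ Suc N) = (1::'a fps)" "qinv j * (1 - fps_X ^ j) = (1::'a fps)"
      by (rule qinv_mult; use assms in simp)+
    have eq: "qfall N j = qinv (Suc N) * (1 - fps_X ^ d) * (qfall (Suc N) j :: 'a fps)"
      using qfall_prev[OF True] by (simp only: d_def)
    have pw: "fps_X ^ Suc N = fps_X ^ d * (fps_X ^ j :: 'a fps)"
      by (simp only: N power_add)
    \<comment> \<open>The identity is polynomial once the powers \<open>q\<^sup>d\<close> and \<open>q\<^sup>j\<close> are treated as independent
      indeterminates.\<close>
    have key: "J * B * (A * (1 - D) * R) + D * J * A * R = J * B * R"
      if "A * (1 - D * J) = 1" "B * (1 - J) = 1" for A B D J R :: "'a fps"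
      using that by algebra
    have "fps_X ^ j * qinv j * (qinv (Suc N) * (1 - fps_X ^ d) * qfall (Suc N) j) +
      fps_X ^ Suc N * qinv (Suc N) * qfall (Suc N) j =
      fps_X ^ j * qinv j * (qfall (Suc N) j :: 'a fps)"
      using * unfolding pw by (rule key)
    then show ?thesis using Suc eq by simp
  qed (use Suc in \<open>simp add: qfall_eq_0\<close>)
qed

text \<open>The increment of \<open>qinv i * qfall N i\<close> from \<open>N\<close> to \<open>N + 1\<close> is, up to the common factor
  \<open>qinv (N + 1)\<close>, the difference of two consecutive falling products, so the increment of the
  right-hand side telescopes to \<open>qinv (N + 1) * qfall (N + 1) j\<close>. The upper limit \<open>M\<close> is kept
  independent of \<open>N\<close> because the induction on \<open>N\<close> needs a fixed range of summation.\<close>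
lemma sum_qinv_qfall:
  assumes "j > 0" "N \<le> M"
  shows "(\<Sum>k=1..N. qinv k * qfall k j) = (\<Sum>i=j..M. qinv i * (qfall N i :: 'a::field fps))"
  using assms(2)
proof (induction N)
  case 0
  then show ?case using assms by (simp add: qfall_eq_0)
next
  case (Suc N)
  have step: "qinv i * qfall (Suc N) i - qinv i * qfall N i
        = qinv (Suc N) * (qfall (Suc N) i - qfall (Suc N) (Suc i) :: 'a fps)" if "i \<ge> j" for i
  proof (cases "i \<le> Suc N")
    case True
    define d where "d = Suc N - i"
    have N: "Suc N = d + i" using True by (simp add: d_def)
    have i: "i > 0" using assms that by simp
    have *: "qinv (Suc N) * (1 - fps_X ^ Suc N) = (1::'a fps)" "qinv i * (1 - fps_X ^ i) = (1::'a fps)"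
      by (rule qinv_mult; use i in simp)+
    have eq: "qfall N i = qinv (Suc N) * (1 - fps_X ^ d) * (qfall (Suc N) i :: 'a fps)"
         "qfall (Suc N) (Suc i) = qfall (Suc N) i * (1 - fps_X ^ d :: 'a fps)"
      using qfall_prev[OF True] qfall_Suc[of "Suc N" i] by (simp_all only: d_def)
    have pw: "fps_X ^ Suc N = fps_X ^ d * (fps_X ^ i :: 'a fps)"
      by (simp only: N power_add)
    have key: "B * R - B * (A * (1 - D) * R) = A * (R - R * (1 - D))"
      if "A * (1 - D * J) = 1" "B * (1 - J) = 1" for A B D J R :: "'a fps"
      using that by algebra
    show ?thesis unfolding eq using * unfolding pw by (rule key)
  qed (simp add: qfall_eq_0)
  have "(\<Sum>i=j..M. qinv i * qfall (Suc N) i) - (\<Sum>i=j..M. qinv i * qfall N i)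
      = qinv (Suc N) * (\<Sum>i=j..M. qfall (Suc N) i - qfall (Suc N) (Suc i) :: 'a fps)"
    unfolding sum_subtractf[symmetric] sum_distrib_left by (intro sum.cong refl step) auto
  also have "(\<Sum>i=j..M. qfall (Suc N) i - qfall (Suc N) (Suc i) :: 'a fps) = qfall (Suc N) j"
  proof (cases "j \<le> M")
    case True
    then have "(\<Sum>i=j..M. qfall (Suc N) (Suc i) - qfall (Suc N) i :: 'a fps)
       = qfall (Suc N) (Suc M) - qfall (Suc N) j"
      by (intro sum_Suc_diff) simp
    then show ?thesis using Suc.prems
      by (simp add: qfall_eq_0 sum_subtractf algebra_simps)
  qed (use Suc.prems in \<open>simp add: qfall_eq_0\<close>)
  finally show ?case using Suc by (simp add: algebra_simps)
qed

text \<open>The weight of the entry in position \<open>j\<close> of a tuple of the third sum. Positions are counted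
  from 0, so the odd-indexed entries \<open>k\<^sub>1, k\<^sub>3, \<dots>\<close> are those with even \<open>j\<close>.\<close>
definition parity_weight :: "nat \<Rightarrow> nat \<Rightarrow> 'a::field fps" where
  "parity_weight j k =
     (if j = 0 then of_nat k else 1) * (if even j then fps_X ^ k else 1) * qinv k"

text \<open>Combinations of the falling products stay of this form under both kinds of summation. Here
  the coefficients merely acquire the eigenvalues.\<close>
lemma sum_weighted_step:
  fixes C :: "nat \<Rightarrow> 'a::field fps"
  shows "(\<Sum>k=1..N. fps_X ^ k * qinv k * (\<Sum>i=1..k. qinv i * qfall k i * C i))
     = (\<Sum>i=1..N. qweight i * qfall N i * C i)"
proof -
  have "(\<Sum>k=1..N. fps_X ^ k * qinv k * (\<Sum>i=1..k. qinv i * qfall k i * C i))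
      = (\<Sum>k=1..N. fps_X ^ k * qinv k * (\<Sum>i=1..N. qinv i * qfall k i * C i))"
    by (intro sum.cong arg_cong2[where f = "(*)"] sum.mono_neutral_left refl)
       (auto simp: qfall_eq_0)
  also have "\<dots> = (\<Sum>i=1..N. \<Sum>k=1..N. qinv i * C i * (fps_X ^ k * qinv k * qfall k i))"
    unfolding sum_distrib_left by (subst sum.swap) (simp only: mult_ac)
  also have "\<dots> = (\<Sum>i=1..N. qinv i * C i * (fps_X ^ i * qinv i * qfall N i))"
    unfolding sum_distrib_left[symmetric] by (intro sum.cong refl) (simp add: sum_X_power_qinv_qfall[simplified])
  also have "\<dots> = (\<Sum>i=1..N. qweight i * qfall N i * C i)"
    by (simp add: qweight_def power2_eq_square mult_ac)
  finally show ?thesis .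
qed

text \<open>Plain summation replaces \<open>qfall k j\<close> by falling products with indices \<open>i \<ge> j\<close>. Collecting
  the terms with the same \<open>i\<close> makes \<open>i\<close> the upper bound for \<open>j\<close>, as in one step of the recursion
  of \<^const>\<open>nested_sum\<close>.\<close>
lemma sum_plain_step:
  fixes C :: "nat \<Rightarrow> 'a::field fps"
  shows "(\<Sum>k=1..N. qinv k * (\<Sum>j=1..k. qweight j * qfall k j * C j))
     = (\<Sum>i=1..N. qinv i * qfall N i * (\<Sum>j=1..i. qweight j * C j))"
proof -
  have "(\<Sum>k=1..N. qinv k * (\<Sum>j=1..k. qweight j * qfall k j * C j))
      = (\<Sum>k=1..N. qinv k * (\<Sum>j=1..N. qweight j * qfall k j * C j))"
    by (intro sum.cong arg_cong2[where f = "(*)"] sum.mono_neutral_left refl)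
       (auto simp: qfall_eq_0)
  also have "\<dots> = (\<Sum>j=1..N. \<Sum>k=1..N. qweight j * C j * (qinv k * qfall k j))"
    unfolding sum_distrib_left by (subst sum.swap) (simp only: mult_ac)
  also have "\<dots> = (\<Sum>j=1..N. qweight j * C j * (\<Sum>i=j..N. qinv i * qfall N i))"
    unfolding sum_distrib_left[symmetric]
    by (intro sum.cong refl) (simp add: sum_qinv_qfall[simplified])
  also have "\<dots> = (\<Sum>j=1..N. \<Sum>i=j..N. qinv i * qfall N i * (qweight j * C j))"
    unfolding sum_distrib_left by (simp only: mult_ac)
  also have "\<dots> = (\<Sum>j=1..N. \<Sum>i\<in>{i\<in>{1..N}. j \<le> i}. qinv i * qfall N i * (qweight j * C j))"
    by (intro sum.cong refl) auto
  also have "\<dots> = (\<Sum>i=1..N. \<Sum>j\<in>{j\<in>{1..N}. j \<le> i}. qinv i * qfall N i * (qweight j * C j))"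
    by (rule sum.swap_restrict) auto
  also have "\<dots> = (\<Sum>i=1..N. \<Sum>j=1..i. qinv i * qfall N i * (qweight j * C j))"
    by (intro sum.cong refl) auto
  finally show ?thesis by (simp add: sum_distrib_left)
qed

text \<open>The identity that transforms chains of length \<open>2 t + 1\<close> with alternating weights into chains
  of length \<open>t + 1\<close>, with largest entry \<open>j\<close>, as in the first sum. Each induction step absorbs one
  plain and one weighted summation.\<close>
lemma nested_sum_parity:
  "nested_sum parity_weight (Suc (2 * t)) N
     = (\<Sum>j=1..N. qweight j * qfall N j * nested_sum (\<lambda>_. qweight) t j :: 'a::field fps)"
proof (induction t arbitrary: N)
  case 0
  \<comment> \<open>The factor \<open>k\<^sub>1\<close> is itself a sum with plain weights, because \<open>qinv l * qfall l 1 = 1\<close>.\<close>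
  have k: "(\<Sum>i=1..k. qinv i * qfall k i * 1) = (of_nat k :: 'a fps)" for k
  proof -
    have "(\<Sum>i=1..k. qinv i * qfall k i) = (\<Sum>l=1..k. qinv l * qfall l 1 :: 'a fps)"
      by (subst sum_qinv_qfall[where M = k]) auto
    also have "\<dots> = (\<Sum>l=1..k. 1)"
      by (intro sum.cong refl) (simp add: qfall_def qinv_mult)
    finally show ?thesis by simp
  qed
  have "nested_sum parity_weight (Suc (2 * 0)) N
     = (\<Sum>k=1..N. fps_X ^ k * qinv k * (of_nat k :: 'a fps))"
    by (simp add: parity_weight_def mult_ac)
  then show ?case
    unfolding k[symmetric] sum_weighted_step by simp
next
  case (Suc t)
  have "nested_sum parity_weight (Suc (Suc (2 * t))) k
      = (\<Sum>i=1..k. qinv i * qfall k i * nested_sum (\<lambda>_. qweight) (Suc t) i :: 'a fps)" for k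
    unfolding nested_sum.simps(2)[of _ "Suc (2 * t)"] Suc.IH nested_sum.simps(2)[of _ t]
      sum_plain_step[symmetric]
    by (simp add: parity_weight_def)
  then have "nested_sum parity_weight (Suc (Suc (Suc (2 * t)))) N
     = (\<Sum>k=1..N. fps_X ^ k * qinv k *
         (\<Sum>i=1..k. qinv i * qfall k i * nested_sum (\<lambda>_. qweight) (Suc t) i) :: 'a fps)"
    unfolding nested_sum.simps(2)[of _ "Suc (Suc (2 * t))"]
    by (simp add: parity_weight_def)
  then show ?case unfolding sum_weighted_step by simp
qed

section \<open>The single alternating sum\<close>

definition alternating_coeff :: "nat \<Rightarrow> 'a::field fps" where
  "alternating_coeff k = (-1) ^ (k - 1) * (1 + fps_X ^ k) * fps_X ^ (k choose 2)"

lemma qratio_Suc: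
  "qratio N (Suc k) = qratio N k * (1 - fps_X ^ (N - k)) * qinv (N + Suc k)"
  by (simp add: qratio_def mult.assoc)

text \<open>For \<open>K = N\<close> the right-hand side vanishes. This gives the case \<open>t = 0\<close> of
  \<open>nested_sum_qweight\<close> below, which amounts to the \<open>q\<close>-binomial expansion of
  \<open>(1 - x)(1 - x q) \<dots> (1 - x q\<^bsup>2N-1\<^esup>)\<close> at its zero \<open>x = q\<^bsup>-N\<^esup>\<close>. The closed form of the partial
  sums reduces it to one step of algebra.\<close>
lemma partial_sum_alternating_coeff:
  assumes "N > 0" "K \<le> N"
  shows "1 - (\<Sum>k=1..K. alternating_coeff k * qratio N k)
    = (-1) ^ K * fps_X ^ (Suc K choose 2) * qratio N K * (1 - fps_X ^ (N - K)) * (qinv N :: 'a::field fps)"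
  using assms(2)
proof (induction K)
  case 0
  then show ?case using qinv[OF assms(1)] by (simp add: qratio_def binomial_eq_0)
next
  case (Suc K)
  define d where "d = N - Suc K"
  have N: "N = d + Suc K" "N - Suc K = d" using Suc.prems by (simp_all add: d_def)
  have *: "qinv N * (1 - fps_X ^ N) = (1::'a fps)"
      "qinv (N + Suc K) * (1 - fps_X ^ (N + Suc K)) = (1::'a fps)"
    by (rule qinv_mult; use assms in simp)+
  have ch: "Suc (Suc K) choose 2 = Suc K + (Suc K choose 2)"
    by (simp add: numeral_2_eq_2)
  have pw: "fps_X ^ N = fps_X ^ d * (fps_X ^ Suc K :: 'a fps)"
      "fps_X ^ (N + Suc K) = fps_X ^ d * fps_X ^ Suc K * (fps_X ^ Suc K :: 'a fps)"
    by (simp_all only: N(1) power_add)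
  have identity: "Q - (1 + Y) * Z = - (Y * Z * (1 - D) * Q)"
    if "Q * (1 - D * Y) = 1" "Z * (1 - D * Y * Y) = 1" for D Q Y Z :: "'a fps"
    using that by algebra
  have key: "qinv N - (1 + fps_X ^ Suc K) * qinv (N + Suc K)
      = - (fps_X ^ Suc K * qinv (N + Suc K) * (1 - fps_X ^ d) * (qinv N :: 'a fps))"
    using * unfolding pw by (rule identity)
  define R where "R = (-1) ^ K * fps_X ^ (Suc K choose 2) * qratio N K * (1 - fps_X ^ (N - K) :: 'a fps)"
  have "1 - (\<Sum>k=1..Suc K. alternating_coeff k * qratio N k :: 'a fps)
     = R * qinv N - alternating_coeff (Suc K) * qratio N (Suc K)"
    using Suc by (simp add: R_def algebra_simps)
  also have "alternating_coeff (Suc K) * qratio N (Suc K) = R * ((1 + fps_X ^ Suc K) * qinv (N + Suc K))"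
    unfolding alternating_coeff_def qratio_Suc R_def by (simp only: diff_Suc_1 mult_ac)
  also have "R * qinv N - R * ((1 + fps_X ^ Suc K) * qinv (N + Suc K))
     = R * - (fps_X ^ Suc K * qinv (N + Suc K) * (1 - fps_X ^ d) * (qinv N :: 'a fps))"
    unfolding key[symmetric] by (simp only: right_diff_distrib)
  also have "\<dots> = (-1) ^ Suc K * fps_X ^ (Suc (Suc K) choose 2) * qratio N (Suc K)
       * (1 - fps_X ^ (N - Suc K)) * qinv N"
    unfolding qratio_Suc R_def ch power_add N(2) by (simp only: power_Suc mult_ac) (simp add: mult_ac)
  finally show ?case .
qed

lemma qratio_prev:
  assumes "k \<le> Suc N"
  shows "qratio N k = (qinv (Suc N))\<^sup>2 * (1 - fps_X ^ (Suc N - k)) * (1 - fps_X ^ (Suc N + k))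
           * (qratio (Suc N) k :: 'a::field fps)"
proof -
  define V where "V M k = (\<Prod>i<k. qinv (M + Suc i) :: 'a fps)" for M k
  have V: "V N k = qinv (Suc N) * (1 - fps_X ^ (Suc N + k)) * V (Suc N) k" for k
  proof (induction k)
    case 0
    then show ?case using qinv[of "Suc N"] by (simp add: V_def mult.commute)
  next
    case (Suc k)
    have V_Suc: "V N (Suc k) = V N k * qinv (Suc N + k)"
        "V (Suc N) (Suc k) = V (Suc N) k * qinv (Suc N + Suc k)"
      by (simp_all add: V_def)
    have identity: "v * e = a * p' * (w * e')" if "v = a * p * w" "p * e = 1" "p' * e' = 1"
      for a e e' p p' v w :: "'a fps"
      using that by algebra
    show ?case
      unfolding V_Suc by (rule identity[OF Suc]) (rule qinv; simp)+
  qed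
  have "qratio M k = qfall M k * V M k" for M
    by (simp add: qratio_def qfall_def V_def prod.distrib)
  from this[of N] this[of "Suc N"] show ?thesis
    unfolding qfall_prev[OF assms] V by (simp only: power2_eq_square mult_ac)
qed

text \<open>Summed against \<open>c\<^sub>k a\<^sub>k\<^sup>t\<close>, this says that the partial fraction expansion satisfies the
  recursion of \<open>h\<^sub>t(N)\<close> in \<open>N\<close>. With \<open>M = N + 1\<close> it rests on
  \<open>(1 - q\<^sup>M)\<^sup>2 - (1 - q\<^bsup>M-k\<^esup>)(1 - q\<^bsup>M+k\<^esup>) = q\<^bsup>M-k\<^esup> (1 - q\<^sup>k)\<^sup>2\<close>.\<close>
lemma qweight_qratio_diff:
  assumes "k > 0"
  shows "qweight k * (qratio (Suc N) k - qratio N k)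
    = qweight (Suc N) * (qratio (Suc N) k :: 'a::field fps)"
proof (cases "k \<le> Suc N")
  case True
  define d where "d = Suc N - k"
  have N: "Suc N = d + k" using True by (simp add: d_def)
  have *: "qinv (Suc N) * (1 - fps_X ^ Suc N) = (1::'a fps)" "qinv k * (1 - fps_X ^ k) = (1::'a fps)"
    by (rule qinv_mult; use assms in simp)+
  have eq: "qratio N k = (qinv (Suc N))\<^sup>2 * (1 - fps_X ^ d) * (1 - fps_X ^ (Suc N + k))
           * (qratio (Suc N) k :: 'a::field fps)"
    using qratio_prev[OF True] by (simp only: d_def)
  have pw: "fps_X ^ Suc N = fps_X ^ d * (fps_X ^ k :: 'a fps)"
      "fps_X ^ (Suc N + k) = fps_X ^ d * fps_X ^ k * (fps_X ^ k :: 'a fps)"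
    by (simp_all only: N power_add)
  have key: "J * B\<^sup>2 * (R - A\<^sup>2 * (1 - D) * (1 - D * J * J) * R) = D * J * A\<^sup>2 * R"
    if "A * (1 - D * J) = 1" "B * (1 - J) = 1" for A B D J R :: "'a fps"
    using that by algebra
  show ?thesis unfolding eq qweight_def using * unfolding pw by (rule key)
qed (simp add: qratio_eq_0)

text \<open>The partial fraction expansion of the complete homogeneous symmetric polynomials of
  \<open>a\<^sub>1, \<dots>, a\<^sub>N\<close>. For \<open>t = N = 0\<close> the left-hand side is 1 and the right-hand side is empty.\<close>
lemma nested_sum_qweight:
  assumes "t > 0 \<or> N > 0"
  shows "nested_sum (\<lambda>_. qweight) t N = (\<Sum>k=1..N. alternating_coeff k * qweight k ^ t * (qratio N k :: 'a::field fps))"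
  using assms
proof (induction t arbitrary: N)
  case 0
  then show ?case using partial_sum_alternating_coeff[of N N] by simp
next
  case (Suc t)
  have IH: "nested_sum (\<lambda>_. qweight) t (Suc N)
    = (\<Sum>k=1..Suc N. alternating_coeff k * qweight k ^ t * (qratio (Suc N) k :: 'a fps))" for N
    by (rule Suc.IH) simp
  show ?case
  proof (induction N)
    case (Suc N)
    have "(\<Sum>k=1..Suc N. alternating_coeff k * qweight k ^ Suc t * qratio (Suc N) k)
          - (\<Sum>k=1..N. alternating_coeff k * qweight k ^ Suc t * qratio N k)
        = (\<Sum>k=1..Suc N. alternating_coeff k * qweight k ^ Suc t * qratio (Suc N) k)
          - (\<Sum>k=1..Suc N. alternating_coeff k * qweight k ^ Suc t * (qratio N k :: 'a fps))"
      by (simp add: qratio_eq_0)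
    also have "\<dots>
        = (\<Sum>k=1..Suc N. alternating_coeff k * qweight k ^ t * (qweight k * (qratio (Suc N) k - qratio N k)))"
      unfolding sum_subtractf[symmetric] by (intro sum.cong refl) (simp add: algebra_simps)
    also have "\<dots> = (\<Sum>k=1..Suc N. alternating_coeff k * qweight k ^ t * (qweight (Suc N) * qratio (Suc N) k))"
      by (intro sum.cong refl) (simp add: qweight_qratio_diff)
    also have "\<dots> = qweight (Suc N) * nested_sum (\<lambda>_. qweight) t (Suc N)"
      unfolding IH sum_distrib_left by (simp only: mult_ac)
    finally show ?case
      using Suc unfolding nested_sum.simps(2)[of _ t]
      by (simp add: algebra_simps)
  qed simp
qed

section \<open>Comparison of coefficients\<close>

lemma nested_sum_parity_nth:
  "nested_sum parity_weight (Suc (2 * t)) N $ N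
     = (nested_sum (\<lambda>_. qweight) (Suc t) N :: 'a::field fps) $ N"
proof -
  have "fps_X ^ Suc N dvd
      qweight j * qfall N j * nested_sum (\<lambda>_. qweight) t j
      - qweight j * (nested_sum (\<lambda>_. qweight) t j :: 'a fps)" if "j \<in> {1..N}" for j
  proof -
    have "fps_X ^ (j + (Suc N - j)) dvd qweight j * (qfall N j - 1 :: 'a fps)"
      unfolding power_add qweight_def
      by (intro mult_dvd_mono X_power_dvd_qfall) simp
    then have "fps_X ^ (j + (Suc N - j)) dvd
        qweight j * (qfall N j - 1) * (nested_sum (\<lambda>_. qweight) t j :: 'a fps)"
      by (rule dvd_mult2)
    then show ?thesis using that by (simp add: algebra_simps)
  qed
  then have "fps_X ^ Suc N dvd
      nested_sum parity_weight (Suc (2 * t)) N - (nested_sum (\<lambda>_. qweight) (Suc t) N :: 'a fps)"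
    unfolding nested_sum_parity nested_sum.simps(2)[of _ t] sum_subtractf[symmetric]
    by (rule dvd_sum)
  then show ?thesis
    using fps_nth_eq_0_of_X_power_dvd[of "Suc N" _ N] by fastforce
qed

lemma sum_alternating_coeff_nth:
  assumes "t > 0"
  shows "(\<Sum>k=1..N. alternating_coeff k * qweight k ^ t) $ N
     = (nested_sum (\<lambda>_. qweight) t N :: 'a::field fps) $ N"
proof -
  have "fps_X ^ Suc N dvd
      alternating_coeff k * qweight k ^ t * qratio N k - alternating_coeff k * (qweight k ^ t :: 'a fps)" if "k \<in> {1..N}" for k
  proof -
    have "fps_X ^ k dvd (qweight k ^ t :: 'a fps)"
      using assms by (cases t) (auto simp: qweight_def)
    then have "fps_X ^ (k + (Suc N - k)) dvd qweight k ^ t * (qratio N k - 1 :: 'a fps)"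
      unfolding power_add by (intro mult_dvd_mono X_power_dvd_qratio)
    then have "fps_X ^ (k + (Suc N - k)) dvd alternating_coeff k * (qweight k ^ t * (qratio N k - 1 :: 'a fps))"
      by (rule dvd_mult)
    then show ?thesis using that by (simp add: algebra_simps)
  qed
  then have "fps_X ^ Suc N dvd
      nested_sum (\<lambda>_. qweight) t N - (\<Sum>k=1..N. alternating_coeff k * (qweight k ^ t :: 'a fps))"
    unfolding nested_sum_qweight[OF disjI1[OF assms]] sum_subtractf[symmetric]
    by (rule dvd_sum)
  then show ?thesis
    using fps_nth_eq_0_of_X_power_dvd[of "Suc N" _ N] by fastforce
qed

text \<open>A tuple with an entry above \<open>N\<close> has last entry above \<open>N\<close>, so a factor \<open>q\<^sup>k\<close> in the weight
  of the last position alone keeps it away from the coefficient of \<open>q\<^sup>N\<close>.\<close>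
lemma has_sum_bounded_tuples:
  fixes f :: "nat \<Rightarrow> nat \<Rightarrow> 'a::comm_ring_1 fps"
  assumes "\<And>k. fps_X ^ k dvd f s k"
    and "\<And>N. nested_sum f (Suc s) N $ N = S $ N"
  shows "((\<lambda>ks. \<Prod>j<Suc s. f j (ks ! j)) has_sum S) (nondec_tuples (Suc s))"
proof (rule has_sum_fps_truncation[where A = "bounded_tuples (Suc s)"])
  fix N ks
  assume ks: "ks \<in> nondec_tuples (Suc s) - bounded_tuples (Suc s) N"
  then obtain k where "k \<in> set ks" "N < k"
    by (auto simp: bounded_tuples_def not_le)
  then obtain i where i: "i < Suc s" "N < ks ! i"
    using ks by (auto simp: nondec_tuples_def in_set_conv_nth)
  with ks have "N < ks ! s"
    using sorted_nth_mono[of ks i s] by (simp add: nondec_tuples_def)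
  moreover have "fps_X ^ (ks ! s) dvd (\<Prod>j<Suc s. f j (ks ! j))"
    using assms(1)[of "ks ! s"] by simp
  ultimately show "(\<Prod>j<Suc s. f j (ks ! j)) $ N = 0"
    by (rule fps_nth_eq_0_of_X_power_dvd[rotated])
next
  fix N
  show "(\<Sum>ks\<in>bounded_tuples (Suc s) N. \<Prod>j<Suc s. f j (ks ! j)) $ N = S $ N"
    unfolding sum_bounded_tuples by (rule assms(2))
  show "bounded_tuples (Suc s) N \<subseteq> nondec_tuples (Suc s)"
    by (auto simp: bounded_tuples_def)
qed (rule finite_bounded_tuples)

section \<open>The three series\<close>

lemma prod_even_powers:
  "(\<Prod>j<Suc (2 * m). if even j then x ^ g j else 1) = (x :: 'a::comm_monoid_mult) ^ (\<Sum>i<Suc m. g (2 * i))"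
proof (induction m)
  case (Suc m)
  have "2 * Suc m = Suc (Suc (2 * m))" by simp
  then show ?case using Suc by (simp add: power_add)
qed simp

theorem corollary4p1:
  fixes t :: nat
  assumes "t \<ge> 1"
  shows
    "let q = (fps_X :: 'a::field_char_0 fps);
         F = (\<lambda>ks. q ^ (\<Sum>j<t. ks ! j) / (\<Prod>j<t. (1 - q ^ (ks ! j))\<^sup>2));
         G = (\<lambda>k::nat. (-1) ^ (k - 1) * (1 + q ^ k) * q ^ ((k choose 2) + t * k)
                 / (1 - q ^ k) ^ (2 * t));
         H = (\<lambda>ks. of_nat (ks ! 0) * q ^ (\<Sum>i<t. ks ! (2 * i))
                 / (\<Prod>j<2 * t - 1. 1 - q ^ (ks ! j)))
     in F summable_on nondec_tuples t
        \<and> G summable_on {1..}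
        \<and> H summable_on nondec_tuples (2 * t - 1)
        \<and> (\<Sum>\<^sub>\<infinity>ks\<in>nondec_tuples t. F ks) = (\<Sum>\<^sub>\<infinity>k\<in>{1..}. G k)
        \<and> (\<Sum>\<^sub>\<infinity>k\<in>{1..}. G k) = (\<Sum>\<^sub>\<infinity>ks\<in>nondec_tuples (2 * t - 1). H ks)"
proof -
  define q where "q = (fps_X :: 'a fps)"
  define F where "F = (\<lambda>ks. q ^ (\<Sum>j<t. ks ! j) / (\<Prod>j<t. (1 - q ^ (ks ! j))\<^sup>2))"
  define G where "G = (\<lambda>k::nat. (-1) ^ (k - 1) * (1 + q ^ k) * q ^ ((k choose 2) + t * k)
                 / (1 - q ^ k) ^ (2 * t))"
  define H where "H = (\<lambda>ks. of_nat (ks ! 0) * q ^ (\<Sum>i<t. ks ! (2 * i))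
                 / (\<Prod>j<2 * t - 1. 1 - q ^ (ks ! j)))"
  obtain m where t: "t = Suc m"
    using assms by (cases t) auto
  \<comment> \<open>The common value, read off from the truncations of the first sum.\<close>
  define S :: "'a fps" where "S = Abs_fps (\<lambda>N. nested_sum (\<lambda>_. qweight) t N $ N)"
  have pos: "ks ! j > 0" if "ks \<in> nondec_tuples s" "j < s" for ks s j
  proof -
    have "ks ! j \<in> set ks" "\<forall>k\<in>set ks. 1 \<le> k"
      using that by (simp_all add: nondec_tuples_def)
    then show ?thesis by fastforce
  qed

  have F: "F ks = (\<Prod>j<t. qweight (ks ! j))" if "ks \<in> nondec_tuples t" for ks
  proof -
    have "(\<Prod>j<t. (1 - q ^ (ks ! j))\<^sup>2) * (\<Prod>j<t. (qinv (ks ! j))\<^sup>2) = (1 :: 'a fps)"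
      unfolding prod.distrib[symmetric] power_mult_distrib[symmetric] q_def
      using pos[OF that] by (intro prod.neutral) (simp add: qinv)
    then show ?thesis
      unfolding F_def by (simp add: fps_divide_eq_mult qweight_def prod.distrib power_sum q_def)
  qed
  have "(F has_sum S) (nondec_tuples t)"
  proof (subst has_sum_cong[OF F], assumption)
    show "((\<lambda>ks. \<Prod>j<t. qweight (ks ! j)) has_sum S) (nondec_tuples t)"
      unfolding t
      by (rule has_sum_bounded_tuples[of "\<lambda>_. qweight"]) (simp_all add: qweight_def S_def t)
  qed
  moreover
  have G: "G k = alternating_coeff k * qweight k ^ t" if "k \<in> {1..}" for k
  proof -
    have "(1 - q ^ k) ^ (2 * t) * qinv k ^ (2 * t) = (1 :: 'a fps)"
      using that by (simp add: power_mult_distrib[symmetric] q_def qinv)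
    then have "G k = (-1) ^ (k - 1) * (1 + q ^ k) * q ^ ((k choose 2) + t * k) * qinv k ^ (2 * t)"
      unfolding G_def by (rule fps_divide_eq_mult)
    moreover have "q ^ (t * k) = (q ^ k) ^ t"
      by (metis mult.commute power_mult)
    moreover have "qinv k ^ (2 * t) = ((qinv k)\<^sup>2 :: 'a fps) ^ t"
      by (rule power_mult)
    ultimately show ?thesis
      by (simp only: alternating_coeff_def qweight_def q_def power_add power_mult_distrib mult_ac)
  qed
  have "(G has_sum S) {1..}"
  proof (subst has_sum_cong[OF G], assumption, rule has_sum_fps_truncation[where A = "\<lambda>N. {1..N}"])
    fix N k :: nat
    assume k: "k \<in> {1..} - {1..N}"
    have "fps_X ^ k dvd alternating_coeff k * (qweight k ^ t :: 'a fps)"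
      by (simp add: t qweight_def)
    then show "(alternating_coeff k * (qweight k ^ t :: 'a fps)) $ N = 0"
      by (rule fps_nth_eq_0_of_X_power_dvd) (use k in auto)
  qed (use sum_alternating_coeff_nth[of t] in \<open>auto simp: S_def t\<close>)
  moreover
  have H: "H ks = (\<Prod>j<2 * t - 1. parity_weight j (ks ! j))"
    if "ks \<in> nondec_tuples (2 * t - 1)" for ks
  proof -
    have *: "(\<Prod>j<2 * t - 1. 1 - q ^ (ks ! j)) * (\<Prod>j<2 * t - 1. qinv (ks ! j)) = (1 :: 'a fps)"
      unfolding prod.distrib[symmetric] q_def
      using pos[OF that] by (intro prod.neutral) (simp add: qinv)
    have "(\<Prod>j<2 * t - 1. if j = 0 then of_nat (ks ! j) else 1) = (of_nat (ks ! 0) :: 'a fps)"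
      by (simp add: t prod.lessThan_Suc_shift del: prod.lessThan_Suc)
    moreover have "(\<Prod>j<2 * t - 1. if even j then q ^ (ks ! j) else 1) = q ^ (\<Sum>i<t. ks ! (2 * i))"
      using prod_even_powers[of q "(!) ks" m] by (simp add: t)
    ultimately show ?thesis
      unfolding H_def fps_divide_eq_mult[OF *]
      by (simp only: parity_weight_def prod.distrib q_def)
  qed
  have "(H has_sum S) (nondec_tuples (2 * t - 1))"
  proof -
    have m: "2 * t - 1 = Suc (2 * m)" by (simp add: t)
    have "((\<lambda>ks. \<Prod>j<2 * t - 1. parity_weight j (ks ! j)) has_sum S) (nondec_tuples (2 * t - 1))"
      unfolding m
    proof (rule has_sum_bounded_tuples)
      show "nested_sum parity_weight (Suc (2 * m)) N $ N = S $ N" for N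
        unfolding nested_sum_parity_nth by (simp only: S_def t fps_nth_Abs_fps)
    qed (simp add: parity_weight_def)
    then show ?thesis
      by (subst has_sum_cong[OF H])
  qed
  ultimately have "F summable_on nondec_tuples t \<and> G summable_on {1..}
        \<and> H summable_on nondec_tuples (2 * t - 1)
        \<and> (\<Sum>\<^sub>\<infinity>ks\<in>nondec_tuples t. F ks) = (\<Sum>\<^sub>\<infinity>k\<in>{1..}. G k)
        \<and> (\<Sum>\<^sub>\<infinity>k\<in>{1..}. G k) = (\<Sum>\<^sub>\<infinity>ks\<in>nondec_tuples (2 * t - 1). H ks)"
    by (auto simp: summable_on_def infsumI)
  then show ?thesis
    unfolding Let_def F_def G_def H_def q_def .
qed

end
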